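(* For any $n\in\mathbb{N}$, $\displaystyle\lim_{k\to\infty}\rho_k^n=1+2\pi$.
   Context: Let $\mathcal{C}$ be the unit circle in the Euclidean plane centered at the origin. For $n,k\in\mathbb{N}$, $k$ treasures are hidden at unknown points $\mathbf{T}=(T_1,\dots,T_k)\in\mathcal{C}^k$, and $n$ robots start at time $0$ at the origin. Each robot moves independently anywhere in the plane (not restricted to $\mathcal{C}$) with speed at most $1$. A treasure is discovered when the position of some robot coincides with it; upon discovery all robots instantly learn its location. A strategy specifies the motion of all $n$ robots, where at each time the motion may depend only on the information about treasures discovered so far; $\mathcal{S}_k^n$ is the set of all valid strategies for $n$ robots and $k$ treasures. For $S\in\mathcal{S}_k^n$ let $\rho_S(\mathbf{T})$ be the time required until every robot has individually visited (been at the location of) every treasure. Define $$\rho_k^n=\inf_{S\in\mathcal{S}_k^n}\ \sup_{\mathbf{T}\in\mathcal{C}^k}\rho_S(\mathbf{T}).$$ *)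

theory Defs
  imports "HOL-Analysis.Analysis"
begin

definition treasure_configs :: "nat \<Rightarrow> (nat \<Rightarrow> complex) set" where
  "treasure_configs k = {..<k} \<rightarrow>\<^sub>E sphere 0 1"

text \<open>The position of robot \<open>r\<close> at time \<open>t\<close> is \<open>m r t\<close>; only \<open>t \<ge> 0\<close> and
  robots numbered below \<open>n\<close> are relevant.\<close>

type_synonym motion = "nat \<Rightarrow> real \<Rightarrow> complex"

definition discovered_at :: "nat \<Rightarrow> motion \<Rightarrow> complex \<Rightarrow> real \<Rightarrow> bool" where
  "discovered_at n m p s \<longleftrightarrow>
     0 \<le> s \<and> (\<exists>r<n. m r s = p) \<and> (\<forall>s'\<in>{0..<s}. \<forall>r<n. m r s' \<noteq> p)"

text \<open>What all robots know at time \<open>t\<close>: which treasures have been found, where and when.\<close>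

definition knowledge ::
    "nat \<Rightarrow> nat \<Rightarrow> motion \<Rightarrow> (nat \<Rightarrow> complex) \<Rightarrow> real \<Rightarrow> (nat \<times> complex \<times> real) set" where
  "knowledge n k m T t =
     {(i, T i, s) | i s. i < k \<and> s \<le> t \<and> discovered_at n m (T i) s}"

text \<open>A strategy assigns to each hidden configuration the resulting motion. It must be
  non-anticipating: the positions at time \<open>t\<close> are a function of \<open>t\<close> and of the knowledge
  at time \<open>t\<close>. Since knowledge records discovery times, equal knowledge at time \<open>t\<close>
  means equal knowledge at all earlier times as well.\<close>

definition strategies :: "nat \<Rightarrow> nat \<Rightarrow> ((nat \<Rightarrow> complex) \<Rightarrow> motion) set" where
  "strategies n k = {S.
     (\<forall>T\<in>treasure_configs k. \<forall>r<n. S T r 0 = 0 \<and> 1-lipschitz_on {0..} (S T r)) \<and>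
     (\<forall>T\<in>treasure_configs k. \<forall>T'\<in>treasure_configs k. \<forall>t\<ge>0.
        knowledge n k (S T) T t = knowledge n k (S T') T' t \<longrightarrow>
        (\<forall>r<n. S T r t = S T' r t))}"

text \<open>The value is \<open>\<infinity>\<close> if some robot never visits some treasure.\<close>

definition completion_time ::
    "nat \<Rightarrow> nat \<Rightarrow> ((nat \<Rightarrow> complex) \<Rightarrow> motion) \<Rightarrow> (nat \<Rightarrow> complex) \<Rightarrow> ereal" where
  "completion_time n k S T =
     Inf {ereal t | t. 0 \<le> t \<and> (\<forall>r<n. \<forall>i<k. \<exists>s\<in>{0..t}. S T r s = T i)}"

definition rho :: "nat \<Rightarrow> nat \<Rightarrow> ereal" where
  "rho n k = (INF S\<in>strategies n k. SUP T\<in>treasure_configs k. completion_time n k S T)"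

end

theory Submission
  imports Defs "HOL-Real_Asymp.Real_Asymp"
begin

text \<open>The upper bound is attained by the oblivious strategy in which every robot walks to the
  circle and then once around it. For the lower bound, hide the treasures at the \<open>k\<close>-th roots of
  unity: whatever the strategy, a single robot needs time \<open>1\<close> to reach its first treasure and at
  least \<open>2 * sin (pi / k)\<close> between any two visits to distinct treasures.\<close>

text \<open>Sum-to-product identities split off the unit factor at the mean angle. This chord length
  serves both bounds: it separates the roots of unity and makes the walk along the circle
  1-Lipschitz.\<close>

lemma norm_cis_diff: "norm (cis a - cis b) = 2 * \<bar>sin ((a - b) / 2)\<bar>"
proof -
  have "cis a - cis b = cis ((a + b) / 2) * (\<i> * complex_of_real (2 * sin ((a - b) / 2)))"
    using cos_diff_cos[of b a] sin_diff_sin[of a b]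
    by (simp add: complex_eq_iff add.commute algebra_simps)
  then show ?thesis by (simp add: norm_mult)
qed

lemma sin_le_sin_between:
  fixes x y :: real
  assumes "0 \<le> y" "y \<le> x" "x \<le> pi - y"
  shows "sin y \<le> sin x"
proof (cases "x \<le> pi / 2")
  case True
  then show ?thesis using assms by (intro sin_monotone_2pi_le) auto
next
  case False
  then have "sin y \<le> sin (pi - x)" using assms by (intro sin_monotone_2pi_le) auto
  then show ?thesis by simp
qed

lemma roots_of_unity_separated:
  assumes "i < k" "j < k" "i \<noteq> j"
  shows "2 * sin (pi / real k) \<le> dist (cis (2 * pi * real i / real k)) (cis (2 * pi * real j / real k))"
  using assms
proof (induction i j rule: linorder_wlog)
  case (le i j)
  \<comment> \<open>Half the angle between the two roots, as in the chord formula. Since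
    \<open>j - i\<close> lies between \<open>1\<close> and \<open>k - 1\<close>, \<open>x\<close>
    stays at least \<open>pi / k\<close> away from both \<open>0\<close> and \<open>pi\<close>; the
    second margin covers neighbours across the angle \<open>0\<close>.\<close>
  define x where "x = pi * (real j - real i) / real k"
  have k: "0 < real k" and ij: "1 \<le> real j - real i" "real j - real i \<le> real k - 1"
    using le by auto
  have "sin (pi / real k) \<le> sin x"
  proof (rule sin_le_sin_between)
    show "pi / real k \<le> x" unfolding x_def
      using k ij(1) by (intro divide_right_mono) auto
    have "x \<le> pi * (real k - 1) / real k" unfolding x_def
      using k ij(2) by (intro divide_right_mono mult_left_mono) auto
    also have "\<dots> = pi - pi / real k" using k by (simp add: field_simps)
    finally show "x \<le> pi - pi / real k" .
  qed simp
  moreover have "dist (cis (2 * pi * real i / real k)) (cis (2 * pi * real j / real k)) = 2 * \<bar>sin x\<bar>"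
    by (subst dist_commute)
      (simp add: dist_norm norm_cis_diff x_def diff_divide_distrib right_diff_distrib)
  ultimately show ?case by linarith
next
  case (sym i j)
  then show ?case by (simp add: dist_commute)
qed

text \<open>Induction adding a new largest element: each addition after the first raises the maximum
  by at least \<open>d\<close>.\<close>

lemma separated_reals_Max_ge:
  fixes A :: "real set"
  assumes "finite A" "A \<noteq> {}" "\<And>x. x \<in> A \<Longrightarrow> a \<le> x"
    and "\<And>x y. x \<in> A \<Longrightarrow> y \<in> A \<Longrightarrow> x \<noteq> y \<Longrightarrow> d \<le> \<bar>x - y\<bar>"
  shows "a + (real (card A) - 1) * d \<le> Max A"
  using assms
proof (induction rule: finite_linorder_max_induct)
  case empty
  then show ?case by simp
next
  case (insert b A)
  have b: "b \<notin> A" using insert by auto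
  have Max_b: "Max (insert b A) = b"
    using insert by (intro Max_eqI) (auto intro: less_imp_le)
  show ?case
  proof (cases "A = {}")
    case True
    then show ?thesis using insert.prems by simp
  next
    case False
    then have "Max A \<in> A" using insert by simp
    then have "Max A < b" "d \<le> \<bar>b - Max A\<bar>" using insert b by auto
    moreover have "a + (real (card A) - 1) * d \<le> Max A"
      using insert False by auto
    ultimately show ?thesis
      unfolding Max_b using insert b by (simp add: algebra_simps)
  qed
qed

text \<open>At unit speed, distances between targets bound differences of visit times, so one visit
  time chosen per target gives a set of reals that starts no earlier than \<open>1\<close> and has
  gaps at least \<open>d\<close>.\<close>

lemma lipschitz_visit_time_ge:
  fixes f :: "real \<Rightarrow> 'a::real_normed_vector" and p :: "nat \<Rightarrow> 'a"
  assumes lip: "1-lipschitz_on {0..} f" and f0: "f 0 = 0" and "k \<ge> 1" and "0 < d"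
    and unit: "\<And>i. i < k \<Longrightarrow> norm (p i) = 1"
    and sep: "\<And>i j. i < k \<Longrightarrow> j < k \<Longrightarrow> i \<noteq> j \<Longrightarrow> d \<le> dist (p i) (p j)"
    and visit: "\<And>i. i < k \<Longrightarrow> \<exists>s\<in>{0..t}. f s = p i"
  shows "1 + (real k - 1) * d \<le> t"
proof -
  obtain s where s: "\<And>i. i < k \<Longrightarrow> s i \<in> {0..t} \<and> f (s i) = p i"
    using visit by metis
  have speed: "dist (f x) (f y) \<le> \<bar>x - y\<bar>" if "0 \<le> x" "0 \<le> y" for x y
    using lipschitz_onD[OF lip, of x y] that by (simp add: dist_real_def)
  have gap: "d \<le> \<bar>s i - s j\<bar>" if "i < k" "j < k" "i \<noteq> j" for i j
    using sep[OF that] speed[of "s i" "s j"] s[OF that(1)] s[OF that(2)] by simp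
  \<comment> \<open>Ensures that there are \<open>k\<close> distinct visit times; here
    \<open>0 < d\<close> matters.\<close>
  have inj: "inj_on s {..<k}"
  proof (rule inj_onI, rule ccontr)
    fix i j assume "i \<in> {..<k}" "j \<in> {..<k}" "s i = s j" "i \<noteq> j"
    then show False using gap[of i j] \<open>0 < d\<close> by simp
  qed
  have start: "1 \<le> s i" if "i < k" for i
    using speed[of "s i" 0] s[OF that] unit[OF that] f0 by auto
  have "1 + (real (card (s ` {..<k})) - 1) * d \<le> Max (s ` {..<k})"
  proof (rule separated_reals_Max_ge)
    show "d \<le> \<bar>x - y\<bar>" if "x \<in> s ` {..<k}" "y \<in> s ` {..<k}" "x \<noteq> y" for x y
      using that gap by blast
  qed (use \<open>k \<ge> 1\<close> start in \<open>auto simp: lessThan_empty_iff\<close>)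
  also have "\<dots> \<le> t" using s \<open>k \<ge> 1\<close> by (subst Max_le_iff) (auto simp: lessThan_empty_iff)
  finally show ?thesis using inj by (simp add: card_image)
qed

lemma rho_lower_bound:
  assumes "n \<ge> 1" "k \<ge> 2"
  shows "ereal (1 + (real k - 1) * (2 * sin (pi / real k))) \<le> rho n k"
  unfolding rho_def
proof (rule INF_greatest)
  fix S assume S: "S \<in> strategies n k"
  \<comment> \<open>\<open>restrict\<close> is needed because configurations form an extensional
    function space. Following robot \<open>0\<close> alone suffices.\<close>
  define T where "T = restrict (\<lambda>i. cis (2 * pi * real i / real k)) {..<k}"
  have T: "T \<in> treasure_configs k"
    by (auto simp: T_def treasure_configs_def)
  have rob: "S T 0 0 = 0" "1-lipschitz_on {0..} (S T 0)"
    using S T \<open>n \<ge> 1\<close> unfolding strategies_def by fastforce+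
  have sin_pos: "sin (pi / real k) > 0"
    using \<open>k \<ge> 2\<close> by (intro sin_gt_zero) (auto simp: field_simps)
  have "1 + (real k - 1) * (2 * sin (pi / real k)) \<le> t"
    if visit: "\<forall>r<n. \<forall>i<k. \<exists>s\<in>{0..t}. S T r s = T i" for t
  proof (rule lipschitz_visit_time_ge[OF rob(2,1)])
    show "\<exists>s\<in>{0..t}. S T 0 s = T i" if "i < k" for i
      using visit that \<open>n \<ge> 1\<close> by simp
    show "2 * sin (pi / real k) \<le> dist (T i) (T j)" if "i < k" "j < k" "i \<noteq> j" for i j
      using roots_of_unity_separated[OF that] that by (simp add: T_def)
    show "norm (T i) = 1" if "i < k" for i
      using that by (simp add: T_def)
  qed (use sin_pos \<open>k \<ge> 2\<close> in auto)
  \<comment> \<open>If some treasure is never visited, the infimum is over the empty set, hence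
    infinite, and the bound still holds.\<close>
  then have "ereal (1 + (real k - 1) * (2 * sin (pi / real k))) \<le> completion_time n k S T"
    unfolding completion_time_def by (intro Inf_greatest) auto
  then show "ereal (1 + (real k - 1) * (2 * sin (pi / real k)))
      \<le> (SUP T\<in>treasure_configs k. completion_time n k S T)"
    using T by (rule SUP_upper2[rotated])
qed

definition sweep :: "real \<Rightarrow> complex" where
  "sweep t = (if t \<le> 1 then of_real t else cis (t - 1))"

lemma sweep_lipschitz: "1-lipschitz_on {0..} sweep"
proof -
  have cis_lip: "1-lipschitz_on {1..b} (\<lambda>t. cis (t - 1))" for b
  proof (rule lipschitz_onI)
    fix x y :: real
    show "dist (cis (x - 1)) (cis (y - 1)) \<le> 1 * dist x y"
      using abs_sin_x_le_abs_x[of "(x - y) / 2"] by (simp add: dist_norm norm_cis_diff)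
  qed simp
  \<comment> \<open>The gluing rule joins adjacent compact intervals, where the two branches agree
    at time \<open>1\<close>. The half-line follows by taking \<open>b\<close> beyond both
    points.\<close>
  have "1-lipschitz_on {0..b} sweep" if "1 \<le> b" for b
    unfolding sweep_def[abs_def]
  proof (rule lipschitz_on_concat)
    show "1-lipschitz_on {0..1} (complex_of_real)"
      by (rule lipschitz_onI) (auto simp: dist_of_real)
  qed (auto intro: cis_lip)
  then have "dist (sweep x) (sweep y) \<le> 1 * dist x y" if "0 \<le> x" "0 \<le> y" for x y
    using that by (intro lipschitz_onD[of 1 "{0..max 1 (max x y)}"]) auto
  then show ?thesis by (intro lipschitz_onI) auto
qed

lemma rho_upper_bound: "rho n k \<le> ereal (1 + 2 * pi)"
proof -
  define S :: "(nat \<Rightarrow> complex) \<Rightarrow> motion" where "S = (\<lambda>T r. sweep)"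
  have "S \<in> strategies n k"
    \<comment> \<open>Non-anticipation is immediate, as \<open>S\<close> ignores the
      configuration.\<close>
    using sweep_lipschitz by (auto simp: strategies_def S_def sweep_def)
  moreover have "completion_time n k S T \<le> ereal (1 + 2 * pi)"
    if T: "T \<in> treasure_configs k" for T
  proof -
    have "\<exists>s\<in>{0..1 + 2 * pi}. sweep s = T i" if "i < k" for i
    proof -
      have "norm (T i) = 1"
        using T that by (auto simp: treasure_configs_def PiE_iff)
      then obtain u where u: "0 \<le> u" "u < 2 * pi" "T i = cis u"
        using complex_unimodular_polar[of "T i"] by (metis cis.code)
      \<comment> \<open>For \<open>u = 0\<close> time \<open>1\<close> falls in the radial branch of
        \<open>sweep\<close>, whose value there is \<open>1\<close>, that is
        \<open>cis 0\<close>.\<close>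
      have "sweep (1 + u) = cis u"
        using u by (cases "u = 0") (auto simp: sweep_def)
      then show ?thesis using u by (intro bexI[of _ "1 + u"]) auto
    qed
    then show ?thesis
      unfolding completion_time_def S_def by (intro Inf_lower) auto
  qed
  ultimately show ?thesis
    unfolding rho_def by (intro INF_lower2[of S] SUP_least)
qed

theorem corollary16:
  fixes n :: nat
  assumes "n \<ge> 1"
  shows "(\<lambda>k. rho n k) \<longlonglongrightarrow> ereal (1 + 2 * pi)"
proof (rule tendsto_sandwich)
  show "\<forall>\<^sub>F k in sequentially. ereal (1 + (real k - 1) * (2 * sin (pi / real k))) \<le> rho n k"
    using eventually_ge_at_top[of 2] by eventually_elim (rule rho_lower_bound[OF assms])
  show "\<forall>\<^sub>F k in sequentially. rho n k \<le> ereal (1 + 2 * pi)"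
    by (simp add: rho_upper_bound)
  \<comment> \<open>Since \<open>sin (pi / k)\<close> is asymptotic to \<open>pi / k\<close>, the
    product tends to \<open>2 * pi\<close>, the perimeter of the circle.\<close>
  have "(\<lambda>k. 1 + (real k - 1) * (2 * sin (pi / real k))) \<longlonglongrightarrow> 1 + 2 * pi"
    by real_asymp
  then show "(\<lambda>k. ereal (1 + (real k - 1) * (2 * sin (pi / real k)))) \<longlonglongrightarrow> ereal (1 + 2 * pi)"
    by simp
qed simp

end
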